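(* Let $M$ be an $n$-dimensional manifold and consider the stochastic differential equation $dx_t=X(x_t)\circ dB_t+A(x_t)\,dt$ on $M$. If the equation is strongly $(n-1)$-complete, then it is strongly complete.
   Context: Setting: $M$ is a connected smooth manifold of dimension $n$; $B_t$ is an $m$-dimensional Brownian motion on a filtered probability space; $X:\mathbb{R}^m\times M\to TM$ is $C^2$ with $X(x):\mathbb{R}^m\to T_xM$ linear for each $x$; $A$ is a $C^2$ vector field; the equation is a Stratonovich equation. $F_t(x)$, $0\le t<\xi(x)$, denotes the maximal solution starting at $x$ with explosion time $\xi(x)$, always taken to be the partial flow: almost surely, for all $t$, $M_t(\omega)=\{x: t<\xi(x,\omega)\}$ is open, $F_t(\cdot,\omega):M_t(\omega)\to M$ is a $C^1$ diffeomorphism onto an open subset of $M$, continuous in $t$ for $C^1$ convergence on compacta, and for compact $K$ with $\xi^K=\inf_{x\in K}\xi(x)$ one has $\lim_{t\nearrow\xi^K}\sup_{x\in K}d(x_0,F_t(x))=\infty$ almost surely on $\{\xi^K<\infty\}$ (for a fixed $x_0\in M$ and any complete metric $d$ on $M$). Let $S_p$ be the set of images of all smooth singular $p$-simplices in $M$ (smooth meaning extending smoothly over an open neighbourhood of the standard $p$-simplex). The equation is strongly $p$-complete if its solution can be chosen to be jointly continuous in time and space almost surely for all time when restricted to any set $K\in S_p$; equivalently, $\xi^K=\infty$ a.s. for every $K\in S_p$. It is strongly complete if the solution can be chosen to be jointly continuous in time and space (on all of $M$) for all time, i.e. $\inf_{x\in M}\xi(x)=\infty$ almost surely (this is the same as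 strong $n$-completeness). *)

theory Defs
  imports "HOL-Probability.Probability" "HOL-Homology.Homology"
begin

section \<open>Smooth manifolds\<close>

text \<open>\<open>C\<^sup>k\<close> maps between finite-dimensional spaces; only used for open sets \<open>S\<close>. In finite
  dimensions the derivative is \<open>C\<^sup>k\<close> iff all its values in fixed directions are.\<close>

primrec Ck_on ::
  "nat \<Rightarrow> 'b::real_normed_vector set \<Rightarrow> ('b \<Rightarrow> 'c::real_normed_vector) \<Rightarrow> bool" where
  "Ck_on 0 S f \<longleftrightarrow> continuous_on S f"
| "Ck_on (Suc k) S f \<longleftrightarrow>
     f differentiable_on S \<and> (\<forall>v. Ck_on k S (\<lambda>x. frechet_derivative f (at x) v))"

definition smooth_on ::
  "'b::real_normed_vector set \<Rightarrow> ('b \<Rightarrow> 'c::real_normed_vector) \<Rightarrow> bool" where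
  "smooth_on S f \<longleftrightarrow> (\<forall>k. Ck_on k S f)"

text \<open>A chart is a pair \<open>(U, \<phi>)\<close>; the values of \<open>\<phi>\<close> outside \<open>U\<close> are irrelevant.\<close>

type_synonym ('a, 'n) chart = "'a set \<times> ('a \<Rightarrow> real ^ 'n)"

abbreviation cinv :: "('a, 'n) chart \<Rightarrow> real ^ 'n \<Rightarrow> 'a" where
  "cinv c \<equiv> inv_into (fst c) (snd c)"

definition is_chart :: "('a::topological_space, 'n::finite) chart \<Rightarrow> bool" where
  "is_chart c \<longleftrightarrow> open (fst c) \<and> open (snd c ` fst c) \<and>
     homeomorphism (fst c) (snd c ` fst c) (snd c) (cinv c)"

text \<open>A smooth structure on the whole type \<open>'a\<close>. The Hausdorff and second countability axioms are
  carried by the type classes, the dimension by the index type \<open>'n\<close>.\<close>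

definition smooth_manifold ::
  "('a::{t2_space, second_countable_topology}, 'n::finite) chart set \<Rightarrow> bool" where
  "smooth_manifold \<A> \<longleftrightarrow>
     (\<forall>c\<in>\<A>. is_chart c) \<and> (\<Union>c\<in>\<A>. fst c) = UNIV \<and>
     (\<forall>c\<in>\<A>. \<forall>c'\<in>\<A>. smooth_on (snd c ` (fst c \<inter> fst c')) (snd c' \<circ> cinv c))"

definition Ck_map ::
  "('a::topological_space, 'n::finite) chart set \<Rightarrow> nat \<Rightarrow> 'a set \<Rightarrow> ('a \<Rightarrow> 'a) \<Rightarrow> bool" where
  "Ck_map \<A> k W f \<longleftrightarrow> continuous_on W f \<and>
     (\<forall>c\<in>\<A>. \<forall>c'\<in>\<A>. Ck_on k (snd c ` (W \<inter> fst c \<inter> f -` fst c')) (snd c' \<circ> f \<circ> cinv c))"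

definition C1_diffeo_onto_open ::
  "('a::topological_space, 'n::finite) chart set \<Rightarrow> 'a set \<Rightarrow> ('a \<Rightarrow> 'a) \<Rightarrow> bool" where
  "C1_diffeo_onto_open \<A> W f \<longleftrightarrow> inj_on f W \<and> open (f ` W) \<and>
     Ck_map \<A> 1 W f \<and> Ck_map \<A> 1 (f ` W) (inv_into W f)"

text \<open>Smooth real functions with compact support.\<close>

definition test_function ::
  "('a::topological_space, 'n::finite) chart set \<Rightarrow> ('a \<Rightarrow> real) \<Rightarrow> bool" where
  "test_function \<A> f \<longleftrightarrow> (\<forall>c\<in>\<A>. smooth_on (snd c ` fst c) (f \<circ> cinv c)) \<and>
     compact (closure {x. f x \<noteq> 0})"

text \<open>A tangent vector at \<open>x\<close> is the family of its coordinate vectors in the charts around \<open>x\<close>,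
  related by the derivatives of the transition maps; it is normalised to 0 elsewhere.\<close>

type_synonym ('a, 'n) tangent = "('a, 'n) chart \<Rightarrow> real ^ 'n"

definition tangent_space ::
  "('a, 'n::finite) chart set \<Rightarrow> 'a \<Rightarrow> ('a, 'n) tangent set" where
  "tangent_space \<A> x = {v.
     (\<forall>c\<in>\<A>. \<forall>c'\<in>\<A>. x \<in> fst c \<inter> fst c' \<longrightarrow>
        v c' = frechet_derivative (snd c' \<circ> cinv c) (at (snd c x)) (v c)) \<and>
     (\<forall>c. c \<notin> \<A> \<or> x \<notin> fst c \<longrightarrow> v c = 0)}"

text \<open>\<open>df\<^sub>x(v)\<close>; by the transformation rule it does not depend on the chart selected.\<close>

definition tangent_deriv ::
  "('a, 'n::finite) chart set \<Rightarrow> ('a \<Rightarrow> real) \<Rightarrow> 'a \<Rightarrow> ('a, 'n) tangent \<Rightarrow> real" where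
  "tangent_deriv \<A> f x v =
     (let c = (SOME c. c \<in> \<A> \<and> x \<in> fst c)
      in frechet_derivative (f \<circ> cinv c) (at (snd c x)) (v c))"

definition C2_vector_field ::
  "('a, 'n::finite) chart set \<Rightarrow> ('a \<Rightarrow> ('a, 'n) tangent) \<Rightarrow> bool" where
  "C2_vector_field \<A> A \<longleftrightarrow> (\<forall>x. A x \<in> tangent_space \<A> x) \<and>
     (\<forall>c\<in>\<A>. Ck_on 2 (snd c ` fst c) (\<lambda>y. A (cinv c y) c))"

text \<open>\<open>X : \<real>\<^sup>m \<times> M \<rightarrow> TM\<close>, of class \<open>C\<^sup>2\<close> and linear in the first argument.\<close>

definition C2_diffusion_coefficient ::
  "('a, 'n::finite) chart set \<Rightarrow> (real ^ 'm::finite \<Rightarrow> 'a \<Rightarrow> ('a, 'n) tangent) \<Rightarrow> bool" where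
  "C2_diffusion_coefficient \<A> X \<longleftrightarrow>
     (\<forall>e x. X e x \<in> tangent_space \<A> x) \<and> (\<forall>x c. linear (\<lambda>e. X e x c)) \<and>
     (\<forall>c\<in>\<A>. Ck_on 2 (UNIV \<times> snd c ` fst c) (\<lambda>(e, y). X e (cinv c y) c))"

section \<open>Smooth singular simplices\<close>

text \<open>\<open>C\<^sup>k\<close> maps on open subsets \<open>W\<close> of \<open>Euclidean_space N\<close>, whose points are functions on \<open>nat\<close>
  vanishing from \<open>N\<close> on, expressed by iterated partial derivatives.\<close>

primrec Ck_Euclidean ::
  "nat \<Rightarrow> nat \<Rightarrow> (nat \<Rightarrow> real) set \<Rightarrow> ((nat \<Rightarrow> real) \<Rightarrow> 'b::real_normed_vector) \<Rightarrow> bool" where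
  "Ck_Euclidean N 0 W g \<longleftrightarrow> continuous_map (subtopology (Euclidean_space N) W) euclidean g"
| "Ck_Euclidean N (Suc k) W g \<longleftrightarrow>
     continuous_map (subtopology (Euclidean_space N) W) euclidean g \<and>
     (\<forall>i<N. (\<forall>x\<in>W. (\<lambda>t. g (x(i := t))) differentiable (at (x i))) \<and>
            Ck_Euclidean N k W (\<lambda>x. vector_derivative (\<lambda>t. g (x(i := t))) (at (x i))))"

definition smooth_Euclidean_map ::
  "('a::topological_space, 'n::finite) chart set \<Rightarrow> nat \<Rightarrow> (nat \<Rightarrow> real) set
     \<Rightarrow> ((nat \<Rightarrow> real) \<Rightarrow> 'a) \<Rightarrow> bool" where
  "smooth_Euclidean_map \<A> N W g \<longleftrightarrow>
     continuous_map (subtopology (Euclidean_space N) W) euclidean g \<and>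
     (\<forall>c\<in>\<A>. \<forall>k. Ck_Euclidean N k (W \<inter> g -` fst c) (snd c \<circ> g))"

text \<open>The standard \<open>p\<close>-simplex lies in \<open>\<real>\<^sup>p\<^sup>+\<^sup>1\<close>, where the open neighbourhood is taken.\<close>

definition smooth_singular_simplex ::
  "('a::topological_space, 'n::finite) chart set \<Rightarrow> nat \<Rightarrow> ((nat \<Rightarrow> real) \<Rightarrow> 'a) \<Rightarrow> bool" where
  "smooth_singular_simplex \<A> p \<sigma> \<longleftrightarrow> singular_simplex p euclidean \<sigma> \<and>
     (\<exists>W g. openin (Euclidean_space (Suc p)) W \<and> standard_simplex p \<subseteq> W \<and>
            smooth_Euclidean_map \<A> (Suc p) W g \<and> (\<forall>x\<in>standard_simplex p. g x = \<sigma> x))"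

definition smooth_simplex_images ::
  "('a::topological_space, 'n::finite) chart set \<Rightarrow> nat \<Rightarrow> 'a set set" where
  "smooth_simplex_images \<A> p = {\<sigma> ` standard_simplex p |\<sigma>. smooth_singular_simplex \<A> p \<sigma>}"

section \<open>Stochastic calculus\<close>

text \<open>Filtrations are indexed by \<open>real\<close>; only the indices \<open>t \<ge> 0\<close> matter.\<close>

definition filtered_prob_space :: "'w measure \<Rightarrow> (real \<Rightarrow> 'w measure) \<Rightarrow> bool" where
  "filtered_prob_space P \<F> \<longleftrightarrow>
     prob_space P \<and> filtration (space P) \<F> \<and> (\<forall>t. subalgebra P (\<F> t))"

definition brownian_motion ::
  "'w measure \<Rightarrow> (real \<Rightarrow> 'w measure) \<Rightarrow> (real \<Rightarrow> 'w \<Rightarrow> real ^ 'm::finite) \<Rightarrow> bool" where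
  "brownian_motion P \<F> B \<longleftrightarrow>
     (\<forall>t\<ge>0. B t \<in> borel_measurable (\<F> t)) \<and>
     (AE \<omega> in P. B 0 \<omega> = 0) \<and>
     (AE \<omega> in P. continuous_on {0..} (\<lambda>t. B t \<omega>)) \<and>
     (\<forall>s t. 0 \<le> s \<and> s < t \<longrightarrow>
        distributed P lborel (\<lambda>\<omega>. B t \<omega> - B s \<omega>)
          (\<lambda>x. ennreal (\<Prod>i\<in>UNIV. normal_density 0 (sqrt (t - s)) (x $ i))) \<and>
        prob_space.indep_set P (sets (\<F> s))
          {(\<lambda>\<omega>. B t \<omega> - B s \<omega>) -` S \<inter> space P |S. S \<in> sets borel})"

definition martingale ::
  "'w measure \<Rightarrow> (real \<Rightarrow> 'w measure) \<Rightarrow> (real \<Rightarrow> 'w \<Rightarrow> real) \<Rightarrow> bool" where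
  "martingale P \<F> N \<longleftrightarrow>
     (\<forall>t\<ge>0. N t \<in> borel_measurable (\<F> t) \<and> integrable P (N t)) \<and>
     (\<forall>s t. 0 \<le> s \<and> s \<le> t \<longrightarrow> (AE \<omega> in P. real_cond_exp P (\<F> s) (N t) \<omega> = N s \<omega>))"

text \<open>Localising sequences may be taken finite, replacing \<open>\<tau> k\<close> by its minimum with \<open>k\<close>.\<close>

definition continuous_local_martingale ::
  "'w measure \<Rightarrow> (real \<Rightarrow> 'w measure) \<Rightarrow> (real \<Rightarrow> 'w \<Rightarrow> real) \<Rightarrow> bool" where
  "continuous_local_martingale P \<F> N \<longleftrightarrow>
     (\<forall>t\<ge>0. N t \<in> borel_measurable (\<F> t)) \<and>
     (AE \<omega> in P. continuous_on {0..} (\<lambda>t. N t \<omega>)) \<and>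
     (\<exists>\<tau> :: nat \<Rightarrow> 'w \<Rightarrow> real.
        (\<forall>k. stopping_time \<F> (\<tau> k) \<and> (\<forall>\<omega>. 0 \<le> \<tau> k \<omega>)) \<and>
        (AE \<omega> in P. incseq (\<lambda>k. \<tau> k \<omega>) \<and> filterlim (\<lambda>k. \<tau> k \<omega>) at_top sequentially) \<and>
        (\<forall>k. martingale P \<F> (\<lambda>t \<omega>. N (min t (\<tau> k \<omega>)) \<omega> - N 0 \<omega>)))"

definition partition_of :: "real \<Rightarrow> nat \<Rightarrow> (nat \<Rightarrow> real) \<Rightarrow> bool" where
  "partition_of t N s \<longleftrightarrow> s 0 = 0 \<and> s N = t \<and> (\<forall>i<N. s i \<le> s (Suc i))"

definition finite_variation :: "(real \<Rightarrow> real) \<Rightarrow> bool" where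
  "finite_variation v \<longleftrightarrow>
     (\<forall>t\<ge>0. \<exists>C. \<forall>N s. partition_of t N s \<longrightarrow> (\<Sum>i<N. \<bar>v (s (Suc i)) - v (s i)\<bar>) \<le> C)"

definition continuous_semimartingale ::
  "'w measure \<Rightarrow> (real \<Rightarrow> 'w measure) \<Rightarrow> (real \<Rightarrow> 'w \<Rightarrow> real) \<Rightarrow> bool" where
  "continuous_semimartingale P \<F> Y \<longleftrightarrow>
     (\<exists>N V. continuous_local_martingale P \<F> N \<and>
        (\<forall>t\<ge>0. V t \<in> borel_measurable (\<F> t)) \<and>
        (AE \<omega> in P. continuous_on {0..} (\<lambda>t. V t \<omega>) \<and> finite_variation (\<lambda>t. V t \<omega>)) \<and>
        (AE \<omega> in P. \<forall>t\<ge>0. Y t \<omega> = N t \<omega> + V t \<omega>))"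

text \<open>\<open>I = \<integral>\<^sub>0\<^sup>t Z \<circ> dW\<close> as the limit in probability of Stratonovich's trapezoidal sums over
  partitions of \<open>[0, t]\<close> with mesh tending to 0. For continuous semimartingales \<open>Z\<close>, \<open>W\<close> this is
  the Ito integral plus half of the bracket of \<open>Z\<close> and \<open>W\<close>.\<close>

definition has_stratonovich_integral ::
  "'w measure \<Rightarrow> (real \<Rightarrow> 'w \<Rightarrow> real) \<Rightarrow> (real \<Rightarrow> 'w \<Rightarrow> real) \<Rightarrow> real \<Rightarrow> ('w \<Rightarrow> real) \<Rightarrow> bool" where
  "has_stratonovich_integral P Z W t I \<longleftrightarrow>
     I \<in> borel_measurable P \<and>
     (\<forall>\<epsilon>>0. \<exists>\<delta>>0. \<forall>N s. partition_of t N s \<and> (\<forall>i<N. s (Suc i) - s i < \<delta>) \<longrightarrow>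
        measure P {\<omega> \<in> space P. \<epsilon> \<le> \<bar>(\<Sum>i<N. (Z (s i) \<omega> + Z (s (Suc i)) \<omega>) / 2
            * (W (s (Suc i)) \<omega> - W (s i) \<omega>)) - I \<omega>\<bar>} \<le> \<epsilon>)"

section \<open>Solution flows\<close>

text \<open>Throughout, \<open>F t x \<omega>\<close> is meaningful only for \<open>0 \<le> t < \<xi> x \<omega>\<close>. A function of compact support
  is evaluated along a solution with the value 0 from the explosion time on.\<close>

definition along ::
  "(real \<Rightarrow> 'a \<Rightarrow> 'w \<Rightarrow> 'a) \<Rightarrow> ('a \<Rightarrow> 'w \<Rightarrow> ereal) \<Rightarrow> 'a \<Rightarrow> ('a \<Rightarrow> real) \<Rightarrow> real \<Rightarrow> 'w \<Rightarrow> real" where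
  "along F \<xi> x h t \<omega> = (if ereal t < \<xi> x \<omega> then h (F t x \<omega>) else 0)"

text \<open>\<open>F \<cdot> x\<close> with lifetime \<open>\<xi> x\<close> solves \<open>dx\<^sub>t = X(x\<^sub>t) \<circ> dB\<^sub>t + A(x\<^sub>t) dt\<close> from \<open>x\<close>: it is a
  continuous adapted process, and for every smooth \<open>f\<close> of compact support \<open>f(x\<^sub>t)\<close> is a
  semimartingale with \<open>f(x\<^sub>t) = f(x) + \<integral>\<^sub>0\<^sup>t df(X(x\<^sub>s)) \<circ> dB\<^sub>s + \<integral>\<^sub>0\<^sup>t df(A(x\<^sub>s)) ds\<close>. This local form
  does not yet say that \<open>\<xi> x\<close> is maximal.\<close>

definition sde_solution_from ::
  "'w measure \<Rightarrow> (real \<Rightarrow> 'w measure) \<Rightarrow> (real \<Rightarrow> 'w \<Rightarrow> real ^ 'm::finite)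
     \<Rightarrow> ('a::topological_space, 'n::finite) chart set
     \<Rightarrow> (real ^ 'm \<Rightarrow> 'a \<Rightarrow> ('a, 'n) tangent) \<Rightarrow> ('a \<Rightarrow> ('a, 'n) tangent)
     \<Rightarrow> (real \<Rightarrow> 'a \<Rightarrow> 'w \<Rightarrow> 'a) \<Rightarrow> ('a \<Rightarrow> 'w \<Rightarrow> ereal) \<Rightarrow> 'a \<Rightarrow> bool" where
  "sde_solution_from P \<F> B \<A> X A F \<xi> x \<longleftrightarrow>
     (\<forall>t\<ge>0. \<forall>S\<in>sets borel.
        {\<omega> \<in> space P. ereal t < \<xi> x \<omega> \<and> F t x \<omega> \<in> S} \<in> sets (\<F> t)) \<and>
     (AE \<omega> in P. 0 < \<xi> x \<omega> \<and> F 0 x \<omega> = x \<and>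
        continuous_on {t. 0 \<le> t \<and> ereal t < \<xi> x \<omega>} (\<lambda>t. F t x \<omega>)) \<and>
     (\<forall>f. test_function \<A> f \<longrightarrow>
        continuous_semimartingale P \<F> (along F \<xi> x f) \<and>
        (\<forall>t\<ge>0. \<exists>I :: 'm \<Rightarrow> 'w \<Rightarrow> real.
           (\<forall>j. has_stratonovich_integral P
                  (along F \<xi> x (\<lambda>y. tangent_deriv \<A> f y (X (axis j 1) y)))
                  (\<lambda>s \<omega>. B s \<omega> $ j) t (I j)) \<and>
           (AE \<omega> in P. along F \<xi> x f t \<omega> = f x + (\<Sum>j\<in>UNIV. I j \<omega>)
              + integral {0..t} (\<lambda>s. along F \<xi> x (\<lambda>y. tangent_deriv \<A> f y (A y)) s \<omega>))))"

definition explosion_time_on :: "('a \<Rightarrow> 'w \<Rightarrow> ereal) \<Rightarrow> 'a set \<Rightarrow> 'w \<Rightarrow> ereal" where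
  "explosion_time_on \<xi> K \<omega> = (INF x\<in>K. \<xi> x \<omega>)"

definition flow_domain :: "('a \<Rightarrow> 'w \<Rightarrow> ereal) \<Rightarrow> real \<Rightarrow> 'w \<Rightarrow> 'a set" where
  "flow_domain \<xi> t \<omega> = {x. ereal t < \<xi> x \<omega>}"

text \<open>Continuity in \<open>t\<close> for \<open>C\<^sup>1\<close> convergence on compacta: in charts \<open>c\<close> and \<open>c'\<close>, uniform
  convergence, on compact sets of starting points, of the local representatives and of their
  derivatives.\<close>

definition C1_continuous_in_time ::
  "('a::topological_space, 'n::finite) chart set \<Rightarrow> (real \<Rightarrow> 'a set) \<Rightarrow> (real \<Rightarrow> 'a \<Rightarrow> 'a) \<Rightarrow> bool"
  where
  "C1_continuous_in_time \<A> D \<phi> \<longleftrightarrow>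
     (\<forall>t0\<ge>0. \<forall>c\<in>\<A>. \<forall>c'\<in>\<A>. \<forall>K. compact K \<and> K \<subseteq> fst c \<inter> D t0 \<and> \<phi> t0 ` K \<subseteq> fst c' \<longrightarrow>
        (\<forall>\<^sub>F t in at t0 within {0..}. K \<subseteq> D t \<and> \<phi> t ` K \<subseteq> fst c') \<and>
        uniform_limit (snd c ` K) (\<lambda>t. snd c' \<circ> \<phi> t \<circ> cinv c) (snd c' \<circ> \<phi> t0 \<circ> cinv c)
          (at t0 within {0..}) \<and>
        (\<forall>v. uniform_limit (snd c ` K)
          (\<lambda>t y. frechet_derivative (snd c' \<circ> \<phi> t \<circ> cinv c) (at y) v)
          (\<lambda>y. frechet_derivative (snd c' \<circ> \<phi> t0 \<circ> cinv c) (at y) v)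
          (at t0 within {0..})))"

text \<open>The pathwise properties of a partial flow, where \<open>d\<close> is a complete metric for the topology of
  \<open>M\<close>. For a complete Riemannian distance \<open>d\<close>, whose bounded closed sets are compact, the
  last clause says that \<open>F t ` K\<close> leaves every compact set at the explosion time of \<open>K\<close>;
  for singletons \<open>K\<close> this is maximality of the solutions.\<close>

definition partial_flow ::
  "'w measure \<Rightarrow> ('a::topological_space, 'n::finite) chart set \<Rightarrow> ('a \<Rightarrow> 'a \<Rightarrow> real) \<Rightarrow> 'a
     \<Rightarrow> (real \<Rightarrow> 'a \<Rightarrow> 'w \<Rightarrow> 'a) \<Rightarrow> ('a \<Rightarrow> 'w \<Rightarrow> ereal) \<Rightarrow> bool" where
  "partial_flow P \<A> d x0 F \<xi> \<longleftrightarrow>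
     (AE \<omega> in P.
        (\<forall>x. 0 < \<xi> x \<omega> \<and> F 0 x \<omega> = x) \<and>
        (\<forall>t\<ge>0. open (flow_domain \<xi> t \<omega>) \<and>
                C1_diffeo_onto_open \<A> (flow_domain \<xi> t \<omega>) (\<lambda>x. F t x \<omega>)) \<and>
        C1_continuous_in_time \<A> (\<lambda>t. flow_domain \<xi> t \<omega>) (\<lambda>t x. F t x \<omega>)) \<and>
     (\<forall>K. compact K \<longrightarrow> (AE \<omega> in P. explosion_time_on \<xi> K \<omega> < \<infinity> \<longrightarrow>
        ((\<lambda>t. SUP x\<in>K. ereal (d x0 (F t x \<omega>))) \<longlongrightarrow> \<infinity>)
          (at_left (real_of_ereal (explosion_time_on \<xi> K \<omega>)))))"

definition complete_metric_for_topology :: "('a::topological_space \<Rightarrow> 'a \<Rightarrow> real) \<Rightarrow> bool" where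
  "complete_metric_for_topology d \<longleftrightarrow> Metric_space UNIV d \<and>
     Metric_space.mtopology UNIV d = euclidean \<and> Metric_space.mcomplete UNIV d"

section \<open>Strong completeness\<close>

text \<open>Solutions from points of \<open>K\<close> have infinite lifetime almost surely and can be chosen, i.e.
  modified for each starting point on a null set, so as to be jointly continuous in time and
  space on \<open>K\<close> for all time.\<close>

definition strongly_complete_on ::
  "'w measure \<Rightarrow> (real \<Rightarrow> 'a::topological_space \<Rightarrow> 'w \<Rightarrow> 'a) \<Rightarrow> ('a \<Rightarrow> 'w \<Rightarrow> ereal) \<Rightarrow> 'a set \<Rightarrow> bool"
  where
  "strongly_complete_on P F \<xi> K \<longleftrightarrow>
     (\<exists>G :: real \<Rightarrow> 'a \<Rightarrow> 'w \<Rightarrow> 'a.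
        (\<forall>x\<in>K. AE \<omega> in P. \<xi> x \<omega> = \<infinity> \<and> (\<forall>t\<ge>0. G t x \<omega> = F t x \<omega>)) \<and>
        (AE \<omega> in P. continuous_on ({0..} \<times> K) (\<lambda>(t, x). G t x \<omega>)))"

definition strongly_p_complete ::
  "'w measure \<Rightarrow> ('a::topological_space, 'n::finite) chart set \<Rightarrow> (real \<Rightarrow> 'a \<Rightarrow> 'w \<Rightarrow> 'a)
     \<Rightarrow> ('a \<Rightarrow> 'w \<Rightarrow> ereal) \<Rightarrow> nat \<Rightarrow> bool" where
  "strongly_p_complete P \<A> F \<xi> p \<longleftrightarrow>
     (\<forall>K\<in>smooth_simplex_images \<A> p. strongly_complete_on P F \<xi> K)"

definition strongly_complete ::
  "'w measure \<Rightarrow> (real \<Rightarrow> 'a::topological_space \<Rightarrow> 'w \<Rightarrow> 'a) \<Rightarrow> ('a \<Rightarrow> 'w \<Rightarrow> ereal) \<Rightarrow> bool" where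
  "strongly_complete P F \<xi> \<longleftrightarrow> strongly_complete_on P F \<xi> UNIV"

end

theory Submission
  imports Defs
begin

text \<open>Let \<open>K\<close> be a closed \<open>n\<close>-simplex in a chart. Its boundary is a finite union of smooth
  \<open>(n - 1)\<close>-simplices, so almost surely no solution starting on it explodes, and by joint
  continuity these solutions stay in a compact set \<open>C\<close> up to any time \<open>T\<close>. As long as \<open>F\<^sub>t\<close> is defined
  on \<open>K\<close>, the compact set \<open>F\<^sub>t(K)\<close> has its frontier inside \<open>C\<close>, because \<open>F\<^sub>t\<close> is an open map. In a
  connected manifold, all compact sets with frontier in \<open>C\<close> lie in one compact set, so \<open>F\<^sub>t(K)\<close>
  cannot leave every bounded set before \<open>T\<close>, and the explosion time of \<open>K\<close> is infinite. Countably
  many such \<open>K\<close> cover \<open>M\<close>.\<close>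

subsection \<open>Topology of manifolds\<close>

lemma homeomorphism_imp_open_image:
  assumes "homeomorphism S T f g" and "open T" and "open U" and "U \<subseteq> S"
  shows "open (f ` U)"
proof -
  have "openin (top_of_set T) (f ` U)"
    using homeomorphism_imp_open_map[OF assms(1)] assms(3,4) openin_open_eq
    by (metis inf.absorb_iff2 openin_open_Int)
  then show ?thesis
    using assms(2) openin_open_trans by blast
qed

lemma open_chart_image:
  assumes "is_chart c" and "open U" and "U \<subseteq> fst c"
  shows "open (snd c ` U)"
  using assms homeomorphism_imp_open_image unfolding is_chart_def by metis

lemma open_chart_preimage:
  assumes "is_chart c" and "open V" and "V \<subseteq> snd c ` fst c"
  shows "open (cinv c ` V)"
  using assms homeomorphism_imp_open_image homeomorphism_symD unfolding is_chart_def by metis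

lemma chartD:
  assumes "is_chart c"
  shows "open (fst c)" and "open (snd c ` fst c)"
    and "continuous_on (fst c) (snd c)" and "continuous_on (snd c ` fst c) (cinv c)"
    and "inj_on (snd c) (fst c)"
    and "\<And>x. x \<in> fst c \<Longrightarrow> cinv c (snd c x) = x"
  using assms unfolding is_chart_def homeomorphism_def
  by (auto intro: inj_on_inverseI[where g = "cinv c"])

lemma manifold_chart_at:
  fixes \<A> :: "('a::{t2_space, second_countable_topology}, 'n::finite) chart set" and x :: 'a
  assumes "smooth_manifold \<A>"
  obtains c where "c \<in> \<A>" and "is_chart c" and "x \<in> fst c"
  using assms unfolding smooth_manifold_def by blast

text \<open>An open and a closed ball of the same radius in a chart. This packages local
  connectedness and local compactness for the confinement argument.\<close>

lemma manifold_neighbourhood: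
  fixes \<A> :: "('a::{t2_space, second_countable_topology}, 'n::finite) chart set" and x :: 'a
  assumes "smooth_manifold \<A>" and "open W" and "x \<in> W"
  obtains U K where "open U" "connected U" "compact K" "x \<in> U" "U \<subseteq> K" "K \<subseteq> W"
proof -
  obtain c where "c \<in> \<A>" and c: "is_chart c" "x \<in> fst c"
    using manifold_chart_at[OF assms(1)] .
  note cD = chartD[OF c(1)]
  have "open (snd c ` (W \<inter> fst c))"
    using open_chart_image[OF c(1)] cD(1) assms(2) by blast
  moreover have "snd c x \<in> snd c ` (W \<inter> fst c)"
    using assms(3) c(2) by blast
  ultimately obtain e where e: "e > 0" "cball (snd c x) e \<subseteq> snd c ` (W \<inter> fst c)"
    using open_contains_cball by blast
  have sub: "ball (snd c x) e \<subseteq> snd c ` fst c" "cball (snd c x) e \<subseteq> snd c ` fst c"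
    using e(2) ball_subset_cball by blast+
  show thesis
  proof
    show "open (cinv c ` ball (snd c x) e)"
      using open_chart_preimage[OF c(1)] sub(1) by blast
    show "connected (cinv c ` ball (snd c x) e)"
      by (rule connected_continuous_image[OF continuous_on_subset[OF cD(4) sub(1)] connected_ball])
    show "compact (cinv c ` cball (snd c x) e)"
      by (rule compact_continuous_image[OF continuous_on_subset[OF cD(4) sub(2)] compact_cball])
    show "x \<in> cinv c ` ball (snd c x) e"
      using cD(6)[OF c(2)] e(1) by (metis centre_in_ball imageI)
    show "cinv c ` ball (snd c x) e \<subseteq> cinv c ` cball (snd c x) e"
      using ball_subset_cball by blast
    have "cinv c ` cball (snd c x) e \<subseteq> cinv c ` snd c ` (W \<inter> fst c)"
      using e(2) by (rule image_mono)
    also have "\<dots> = (\<lambda>y. y) ` (W \<inter> fst c)"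
      unfolding image_image by (rule image_cong) (use cD(6) in auto)
    finally show "cinv c ` cball (snd c x) e \<subseteq> W"
      by simp
  qed
qed

text \<open>A compact set \<open>N\<close> with frontier in \<open>C\<close> is determined, up to a fixed compact neighbourhood
  \<open>closure V\<close> of \<open>C\<close>, by which of finitely many connected sets covering \<open>frontier V\<close> it contains:
  if \<open>N\<close> and \<open>N'\<close> contain the same ones, then \<open>N - (closure V \<union> N')\<close> is open and closed.\<close>

lemma compact_sets_with_frontier_confined:
  fixes \<A> :: "('a::{t2_space, second_countable_topology}, 'n::finite) chart set"
  assumes mfd: "smooth_manifold \<A>" and conn: "connected (UNIV :: 'a set)" and C: "compact C"
  obtains C' :: "'a set" where "compact C'"
    and "\<And>N. compact N \<Longrightarrow> frontier N \<subseteq> C \<Longrightarrow> N \<subseteq> C'"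
proof -
  have "\<exists>U K. open U \<and> compact K \<and> x \<in> U \<and> U \<subseteq> K" for x :: 'a
    using manifold_neighbourhood[OF mfd open_UNIV, of x] by (metis UNIV_I)
  then obtain U K where UK: "\<And>x::'a. open (U x)" "\<And>x. compact (K x)" "\<And>x. x \<in> U x" "\<And>x. U x \<subseteq> K x"
    by metis
  \<comment> \<open>An arbitrary point, added so that \<open>V\<close> is nonempty even if
    \<open>C\<close> is empty; this excludes \<open>E = UNIV\<close> at the end.\<close>
  define y :: 'a where "y = undefined"
  have yC: "compact (insert y C)" "insert y C \<subseteq> (\<Union>x. U x)"
    using C UK(3) by (auto simp: compact_insert)
  obtain J where J: "J \<subseteq> UNIV" "finite J" "insert y C \<subseteq> (\<Union>x\<in>J. U x)"
    by (rule compactE_image[OF yC(1) _ yC(2)]) (use UK(1) in auto)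
  define V where "V = (\<Union>x\<in>J. U x)"
  have V: "open V" "C \<subseteq> V" "V \<noteq> {}"
    using J UK(1) by (auto simp: V_def)
  have "V \<subseteq> (\<Union>x\<in>J. K x)" "compact (\<Union>x\<in>J. K x)"
    using UK(2,4) J(2) by (auto simp: V_def)
  then have clV: "compact (closure V)"
    by (metis closed_closure closure_minimal compact_Int_closed compact_imp_closed inf.absorb2)
  have clC: "closed C"
    using C compact_imp_closed by blast
  have frV: "compact (frontier V)" "frontier V \<inter> V = {}"
    using clV V(1) by (auto simp: frontier_def interior_open intro: compact_diff)
  \<comment> \<open>These sets avoid \<open>C\<close>. Being connected, each of them is either
    contained in or disjoint from any compact set with frontier in \<open>C\<close>.\<close>
  have "\<exists>O'. open O' \<and> connected O' \<and> x \<in> O' \<and> O' \<inter> C = {}" if "x \<in> frontier V" for x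
  proof -
    have "open (- C)" "x \<in> - C"
      using clC frV(2) V(2) that by auto
    then show ?thesis
      using manifold_neighbourhood[OF mfd, of "- C" x] by (metis Compl_disjoint2 disjoint_eq_subset_Compl subset_trans)
  qed
  then obtain O' where O': "\<And>x. x \<in> frontier V \<Longrightarrow> open (O' x) \<and> connected (O' x) \<and> x \<in> O' x \<and> O' x \<inter> C = {}"
    by metis
  have frV3: "frontier V \<subseteq> (\<Union>x\<in>frontier V. O' x)"
    using O' by blast
  obtain I where I: "I \<subseteq> frontier V" "finite I" "frontier V \<subseteq> (\<Union>x\<in>I. O' x)"
    by (rule compactE_image[OF frV(1) _ frV3]) (use O' in auto)
  \<comment> \<open>\<open>inside N\<close> is a subset of the finite set \<open>I\<close>, so only
    finitely many patterns occur. One representative for each of them, together with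
    \<open>closure V\<close>, makes up the bound \<open>C'\<close>.\<close>
  define inside where "inside N = {i \<in> I. O' i \<subseteq> N}" for N
  define adm where "adm N \<longleftrightarrow> compact N \<and> frontier N \<subseteq> C" for N
  define rep where "rep Q = (SOME N. adm N \<and> inside N = Q)" for Q
  have rep: "adm (rep (inside N)) \<and> inside (rep (inside N)) = inside N" if "adm N" for N
    unfolding rep_def by (rule someI[of _ N]) (use that in auto)
  define C' where "C' = closure V \<union> (\<Union>Q\<in>inside ` Collect adm. rep Q)"
  have "finite (inside ` Collect adm)"
    by (rule finite_subset[of _ "Pow I"]) (use I(2) in \<open>auto simp: inside_def\<close>)
  moreover have "\<forall>Q\<in>inside ` Collect adm. compact (rep Q)"
    using rep by (force simp: adm_def)
  ultimately have "compact (\<Union>Q\<in>inside ` Collect adm. rep Q)"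
    by (metis compact_UN)
  then have "compact C'"
    unfolding C'_def using clV by (rule compact_Un[rotated])
  moreover have "N \<subseteq> C'" if "compact N" "frontier N \<subseteq> C" for N
  proof -
    define N' where "N' = rep (inside N)"
    have N: "adm N"
      using that adm_def by simp
    have N': "adm N'" "inside N' = inside N"
      using rep[OF N] N'_def by auto
    \<comment> \<open>The frontier of an admissible set lies in \<open>C\<close>, hence in
      \<open>V\<close>, so outside \<open>V\<close> the set and its interior agree.\<close>
    have int: "Z - V = interior Z - V" if "adm Z" for Z
      using that V(2) compact_imp_closed interior_subset
      unfolding adm_def frontier_def by (fastforce dest: closure_closed)
    have cls: "closed N" "closed N'"
      using N N' adm_def compact_imp_closed by auto
    \<comment> \<open>Here the equality of patterns enters: an \<open>O' i\<close> that meets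
      \<open>N\<close> lies in \<open>N\<close>, hence also in \<open>N'\<close>.\<close>
    have sub: "N \<inter> frontier V \<subseteq> interior N'"
    proof
      fix x assume x: "x \<in> N \<inter> frontier V"
      then obtain i where i: "i \<in> I" "x \<in> O' i"
        using I(3) by blast
      have "O' i \<inter> frontier N = {}" "connected (O' i)" "O' i \<inter> N \<noteq> {}"
        using O' I(1) i N x unfolding adm_def by blast+
      then have "O' i \<subseteq> N"
        using connected_Int_frontier by blast
      then have "O' i \<subseteq> N'"
        using N'(2) i(1) unfolding inside_def by blast
      then show "x \<in> interior N'"
        using O' I(1) i interior_maximal by blast
    qed
    \<comment> \<open>Two descriptions of \<open>E\<close> follow. The first subtracts an open set
      from a closed one: by \<open>sub\<close>, removing \<open>frontier V\<close> costs nothing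
      once \<open>interior N'\<close> is removed. The second subtracts a closed set from an open
      one.\<close>
    define E where "E = N - (closure V \<union> N')"
    have "closure V = V \<union> frontier V"
      using V(1) closure_subset by (auto simp: frontier_def interior_open)
    then have "E = N - (V \<union> interior N')"
      unfolding E_def using sub int[OF N'(1)] interior_subset[of N'] by blast
    then have "closed E"
      using cls V(1) by (simp add: closed_Diff open_Un)
    have "E = interior N - (closure V \<union> N')"
      unfolding E_def using int[OF N] closure_subset[of V] by blast
    then have "open E"
      using cls by (simp add: open_Diff closed_Un)
    with \<open>closed E\<close> have "E = {} \<or> E = UNIV"
      using conn connected_clopen[of "UNIV :: 'a set"] by auto
    moreover have "E \<noteq> UNIV"
      using V(3) closure_subset unfolding E_def by blast
    ultimately show ?thesis
      unfolding C'_def E_def N'_def using N by blast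
  qed
  ultimately show thesis
    using that by blast
qed

subsection \<open>Paths of partial flows\<close>

text \<open>Uniform convergence in \<open>t\<close> on a compact neighbourhood \<open>K\<close> of
  \<open>x\<close> and continuity of the single map \<open>\<phi> s\<close> combine to joint
  continuity, each accounting for half of \<open>e\<close> in the chart \<open>c'\<close>.\<close>

lemma C1_continuous_in_time_imp_continuous_on:
  fixes \<A> :: "('a::{t2_space, second_countable_topology}, 'n::finite) chart set"
  assumes mfd: "smooth_manifold \<A>" and C1: "C1_continuous_in_time \<A> D \<phi>"
    and D: "\<And>t. t \<ge> 0 \<Longrightarrow> open (D t)" and \<phi>: "\<And>t. t \<ge> 0 \<Longrightarrow> continuous_on (D t) (\<phi> t)"
  shows "continuous_on (SIGMA t:{0..}. D t) (\<lambda>(t, x). \<phi> t x)"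
  unfolding continuous_on_topological
proof (clarsimp)
  fix s x V
  assume s: "0 \<le> s" and x: "x \<in> D s" and V: "open V" "\<phi> s x \<in> V"
  obtain c where c: "c \<in> \<A>" "is_chart c" "x \<in> fst c"
    using manifold_chart_at[OF mfd] by metis
  obtain c' where c': "c' \<in> \<A>" "is_chart c'" "\<phi> s x \<in> fst c'"
    using manifold_chart_at[OF mfd] by metis
  note cD = chartD[OF c(2)] and cD' = chartD[OF c'(2)]
  define z where "z = snd c' (\<phi> s x)"
  have "open (snd c' ` (V \<inter> fst c'))" "z \<in> snd c' ` (V \<inter> fst c')"
    using V cD'(1) c'(3) open_chart_image[OF c'(2)] by (auto simp: z_def)
  then obtain e where e: "e > 0" "ball z e \<subseteq> snd c' ` (V \<inter> fst c')"
    using open_contains_ball by blast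
  define W1 where "W1 = D s \<inter> \<phi> s -` fst c'"
  have W1: "open W1"
    unfolding W1_def by (rule continuous_open_preimage[OF \<phi>[OF s] D[OF s] cD'(1)])
  have cont: "continuous_on W1 (snd c' \<circ> \<phi> s)"
    by (intro continuous_on_compose continuous_on_subset[OF \<phi>[OF s]] continuous_on_subset[OF cD'(3)])
      (auto simp: W1_def)
  \<comment> \<open>On \<open>W\<close> the map \<open>\<phi> s\<close> itself stays within
    \<open>e/2\<close> of \<open>z\<close>; a compact neighbourhood inside \<open>W\<close> is what
    the uniform limit can be applied to.\<close>
  define W where "W = fst c \<inter> (W1 \<inter> (snd c' \<circ> \<phi> s) -` ball z (e/2))"
  have "open (W1 \<inter> (snd c' \<circ> \<phi> s) -` ball z (e/2))"
    by (rule continuous_open_preimage[OF cont W1 open_ball])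
  then have "open W"
    unfolding W_def using cD(1) by blast
  moreover have "x \<in> W"
    using c(3) x c'(3) e(1) by (simp add: W_def W1_def z_def)
  ultimately obtain U K where UK: "open U" "compact K" "x \<in> U" "U \<subseteq> K" "K \<subseteq> W"
    using manifold_neighbourhood[OF mfd] by metis
  have K: "compact K \<and> K \<subseteq> fst c \<inter> D s \<and> \<phi> s ` K \<subseteq> fst c'"
    using UK by (auto simp: W_def W1_def)
  have ev1: "\<forall>\<^sub>F t in at s within {0..}. K \<subseteq> D t \<and> \<phi> t ` K \<subseteq> fst c'"
    and "uniform_limit (snd c ` K) (\<lambda>t. snd c' \<circ> \<phi> t \<circ> cinv c) (snd c' \<circ> \<phi> s \<circ> cinv c) (at s within {0..})"
    using C1 s c(1) c'(1) K unfolding C1_continuous_in_time_def by blast+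
  then have ev2: "\<forall>\<^sub>F t in at s within {0..}. \<forall>y\<in>snd c ` K.
      dist ((snd c' \<circ> \<phi> t \<circ> cinv c) y) ((snd c' \<circ> \<phi> s \<circ> cinv c) y) < e/2"
    using e(1) unfolding uniform_limit_iff by (meson half_gt_zero)
  define good where "good t \<longleftrightarrow> \<phi> t ` K \<subseteq> fst c' \<and> (\<forall>y\<in>K. dist (snd c' (\<phi> t y)) (snd c' (\<phi> s y)) < e/2)" for t
  have "\<forall>\<^sub>F t in at s within {0..}. good t"
    using ev1 ev2
  proof eventually_elim
    case (elim t)
    then show ?case
      using cD(6) K unfolding good_def by fastforce
  qed
  then obtain T where T: "open T" "s \<in> T" "\<And>t. t \<in> T \<Longrightarrow> t \<noteq> s \<Longrightarrow> t \<ge> 0 \<Longrightarrow> good t"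
    unfolding eventually_at_topological by auto
  \<comment> \<open>The filter \<open>at s\<close> leaves out the time \<open>s\<close>, which is
    therefore treated separately.\<close>
  have "good s"
    using K e(1) by (simp add: good_def)
  then have good: "good t" if "t \<in> T" "t \<ge> 0" for t
    using T(3) that by blast
  have "\<phi> t y \<in> V" if "t \<in> T" "t \<ge> 0" "y \<in> U" for t y
  proof -
    have y: "y \<in> K"
      using that UK by blast
    then have "dist z (snd c' (\<phi> s y)) < e/2"
      using UK(5) by (auto simp: W_def)
    moreover have "dist (snd c' (\<phi> t y)) (snd c' (\<phi> s y)) < e/2" and 1: "\<phi> t y \<in> fst c'"
      using good[OF that(1,2)] y unfolding good_def by auto
    ultimately have "snd c' (\<phi> t y) \<in> ball z e"
      using dist_triangle_half_r by (metis dist_commute mem_ball)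
    then obtain w where w: "w \<in> V" "w \<in> fst c'" "snd c' (\<phi> t y) = snd c' w"
      using e(2) by blast
    then show ?thesis
      using inj_onD[OF cD'(5) w(3) 1 w(2)] by simp
  qed
  then show "\<exists>A. open A \<and> (s, x) \<in> A \<and> (\<forall>t\<in>{0..}. \<forall>y\<in>D t. (t, y) \<in> A \<longrightarrow> \<phi> t y \<in> V)"
    using T UK by (intro exI[of _ "T \<times> U"]) (auto intro: open_Times)
qed

lemma C1_diffeo_continuous_on: "C1_diffeo_onto_open \<A> W f \<Longrightarrow> continuous_on W f"
  unfolding C1_diffeo_onto_open_def Ck_map_def by blast

text \<open>The continuous inverse makes \<open>f\<close> a homeomorphism between open sets, so
  invariance of domain is not invoked.\<close>

lemma C1_diffeo_open_image:
  assumes "C1_diffeo_onto_open \<A> W f" and "open W" and "open U" and "U \<subseteq> W"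
  shows "open (f ` U)"
proof (rule homeomorphism_imp_open_image)
  show "homeomorphism W (f ` W) f (inv_into W f)"
    using assms(1) unfolding C1_diffeo_onto_open_def Ck_map_def
    by (intro homeomorphismI) (auto simp: f_inv_into_f inv_into_into)
  show "open (f ` W)"
    using assms(1) by (simp add: C1_diffeo_onto_open_def)
qed (use assms in auto)

text \<open>The set \<open>K - U\<close> stands for the boundary of a simplex, on which nothing
  explodes. Its trajectory up to \<open>T\<close> is compact and does not depend on
  \<open>t\<close>, so a single \<open>C\<close> serves all times up to \<open>T\<close> at which
  \<open>K\<close> is still in the domain.\<close>

lemma flow_images_confined:
  fixes \<A> :: "('a::{t2_space, second_countable_topology}, 'n::finite) chart set"
  assumes mfd: "smooth_manifold \<A>" and conn: "connected (UNIV :: 'a set)"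
    and C1: "C1_continuous_in_time \<A> D \<phi>"
    and D: "\<And>t. t \<ge> 0 \<Longrightarrow> open (D t)" and diffeo: "\<And>t. t \<ge> 0 \<Longrightarrow> C1_diffeo_onto_open \<A> (D t) (\<phi> t)"
    and K: "compact K" and U: "open U" "U \<subseteq> K"
    and bd: "\<And>t. t \<ge> 0 \<Longrightarrow> K - U \<subseteq> D t"
  obtains C where "compact C" and "\<And>t. 0 \<le> t \<Longrightarrow> t \<le> T \<Longrightarrow> K \<subseteq> D t \<Longrightarrow> \<phi> t ` K \<subseteq> C"
proof -
  have \<phi>: "continuous_on (D t) (\<phi> t)" if "t \<ge> 0" for t
    using diffeo[OF that] by (rule C1_diffeo_continuous_on)
  have "continuous_on (SIGMA t:{0..}. D t) (\<lambda>(t, x). \<phi> t x)"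
    by (rule C1_continuous_in_time_imp_continuous_on[OF mfd C1 D \<phi>])
  then have "continuous_on ({0..T} \<times> (K - U)) (\<lambda>(t, x). \<phi> t x)"
    by (rule continuous_on_subset) (force dest: subsetD[OF bd])
  moreover have "compact ({0..T} \<times> (K - U))"
    using K U by (intro compact_Times compact_diff) auto
  ultimately have "compact ((\<lambda>(t, x). \<phi> t x) ` ({0..T} \<times> (K - U)))"
    by (rule compact_continuous_image)
  then obtain C where C: "compact C"
    "\<And>N. compact N \<Longrightarrow> frontier N \<subseteq> (\<lambda>(t, x). \<phi> t x) ` ({0..T} \<times> (K - U)) \<Longrightarrow> N \<subseteq> C"
    using compact_sets_with_frontier_confined[OF mfd conn] by metis
  show thesis
  proof
    fix t assume t: "0 \<le> t" "t \<le> T" "K \<subseteq> D t"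
    have comp: "compact (\<phi> t ` K)"
      by (rule compact_continuous_image[OF continuous_on_subset[OF \<phi>[OF t(1)] t(3)] K])
    \<comment> \<open>Images of points of \<open>U\<close> are interior to the image of
      \<open>K\<close>, so its frontier can only come from \<open>K - U\<close>.\<close>
    have "open (\<phi> t ` U)"
      using t U(2) by (intro C1_diffeo_open_image[OF diffeo[OF t(1)] D[OF t(1)] U(1)]) blast
    then have "\<phi> t ` U \<subseteq> interior (\<phi> t ` K)"
      using U(2) by (simp add: image_mono interior_maximal)
    then have "frontier (\<phi> t ` K) \<subseteq> \<phi> t ` (K - U)"
      using compact_imp_closed[OF comp] by (auto simp: frontier_def)
    also have "\<dots> \<subseteq> (\<lambda>(t, x). \<phi> t x) ` ({0..T} \<times> (K - U))"
      using t by force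
    finally show "\<phi> t ` K \<subseteq> C"
      using C(2) comp by blast
  qed (rule C(1))
qed

subsection \<open>Explosion times\<close>

lemma complete_metric_bounded_on_compact:
  assumes "complete_metric_for_topology d" and "compact C"
  obtains R where "\<And>y. y \<in> C \<Longrightarrow> d x0 y \<le> R"
proof -
  interpret Metric_space UNIV d
    using assms(1) by (simp add: complete_metric_for_topology_def)
  have "compactin mtopology (insert x0 C)"
    using assms by (simp add: complete_metric_for_topology_def)
  then show thesis
    using compactin_imp_mbounded that unfolding mbounded_alt by blast
qed

text \<open>An infimum of positive lifetimes could be zero. Compactness excludes this: the open flow
  domains at positive times cover \<open>K\<close>, and finitely many suffice.\<close>

lemma explosion_time_on_pos:
  assumes "compact K" and "\<And>t. t \<ge> 0 \<Longrightarrow> open (flow_domain \<xi> t \<omega>)" and "\<And>x. 0 < \<xi> x \<omega>"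
  shows "0 < explosion_time_on \<xi> K \<omega>"
proof -
  have "\<exists>t>0. ereal t < \<xi> x \<omega>" for x
    using ereal_dense2[OF assms(3)[of x]] by auto
  then have cover: "K \<subseteq> (\<Union>t\<in>{0<..}. flow_domain \<xi> t \<omega>)"
    by (fastforce simp: flow_domain_def)
  obtain J where J: "J \<subseteq> {0<..}" "finite J" "K \<subseteq> (\<Union>t\<in>J. flow_domain \<xi> t \<omega>)"
    by (rule compactE_image[OF assms(1) _ cover]) (use assms(2) in auto)
  \<comment> \<open>The extra element 1 keeps the minimum meaningful when \<open>J\<close> is
    empty.\<close>
  define r where "r = Min (insert 1 J)"
  have r: "r > 0" "\<And>t. t \<in> J \<Longrightarrow> r \<le> t"
    using J by (auto simp: r_def)
  have "ereal r \<le> explosion_time_on \<xi> K \<omega>"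
    unfolding explosion_time_on_def
  proof (rule INF_greatest)
    fix x assume "x \<in> K"
    then obtain t where t: "t \<in> J" "ereal t < \<xi> x \<omega>"
      using J(3) by (auto simp: flow_domain_def)
    then show "ereal r \<le> \<xi> x \<omega>"
      using r(2)[OF t(1)] by (meson ereal_less_eq(3) less_imp_le order_trans)
  qed
  then show ?thesis
    using r(1) by (metis ereal_less(2) less_le_trans)
qed

text \<open>At a finite explosion time \<open>T\<close> of \<open>K\<close> the distance from
  \<open>x0\<close> would diverge, whereas just before \<open>T\<close> all of \<open>K\<close> is
  in the domain and its images lie in one compact, hence bounded, set.\<close>

lemma no_explosion_of_confined:
  assumes flow: "partial_flow P \<A> d x0 F \<xi>" and d: "complete_metric_for_topology d" and K: "compact K"
    and conf: "AE \<omega> in P. \<forall>T\<ge>0. \<exists>C. compact C \<and>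
      (\<forall>t. 0 \<le> t \<and> t \<le> T \<and> K \<subseteq> flow_domain \<xi> t \<omega> \<longrightarrow> (\<lambda>x. F t x \<omega>) ` K \<subseteq> C)"
  shows "AE \<omega> in P. \<forall>x\<in>K. \<xi> x \<omega> = \<infinity>"
proof -
  have "AE \<omega> in P. (\<forall>x. 0 < \<xi> x \<omega>) \<and> (\<forall>t\<ge>0. open (flow_domain \<xi> t \<omega>))"
    using flow unfolding partial_flow_def by (auto elim!: AE_mp)
  moreover have "AE \<omega> in P. explosion_time_on \<xi> K \<omega> < \<infinity> \<longrightarrow>
        ((\<lambda>t. SUP x\<in>K. ereal (d x0 (F t x \<omega>))) \<longlongrightarrow> \<infinity>)
          (at_left (real_of_ereal (explosion_time_on \<xi> K \<omega>)))"
    using flow K unfolding partial_flow_def by blast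
  ultimately show ?thesis
    using conf
  proof eventually_elim
    case (elim \<omega>)
    have "\<not> explosion_time_on \<xi> K \<omega> < \<infinity>"
    proof
      assume fin: "explosion_time_on \<xi> K \<omega> < \<infinity>"
      \<comment> \<open>Positivity makes the explosion time a real number and leaves positive times
        immediately to its left.\<close>
      have "0 < explosion_time_on \<xi> K \<omega>"
        by (rule explosion_time_on_pos[OF K]) (use elim(1) in auto)
      with fin obtain T where T: "explosion_time_on \<xi> K \<omega> = ereal T" "T > 0"
        by (cases "explosion_time_on \<xi> K \<omega>") auto
      have lim: "((\<lambda>t. SUP x\<in>K. ereal (d x0 (F t x \<omega>))) \<longlongrightarrow> \<infinity>) (at_left T)"
        using elim(2) fin T(1) by simp
      obtain C where C: "compact C"
        "\<forall>t. 0 \<le> t \<and> t \<le> T \<and> K \<subseteq> flow_domain \<xi> t \<omega> \<longrightarrow> (\<lambda>x. F t x \<omega>) ` K \<subseteq> C"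
        using elim(3)[rule_format, OF less_imp_le[OF T(2)]] by blast
      obtain R where R: "\<And>y. y \<in> C \<Longrightarrow> d x0 y \<le> R"
        using complete_metric_bounded_on_compact[OF d C(1)] by metis
      have "\<forall>\<^sub>F t in at_left T. ereal R < (SUP x\<in>K. ereal (d x0 (F t x \<omega>)))"
        using order_tendstoD(1)[OF lim, of "ereal R"] by simp
      moreover have "\<forall>\<^sub>F t in at_left T. 0 < t \<and> t < T"
        using T(2) eventually_at_left_real[OF T(2)] by (auto elim: eventually_mono)
      \<comment> \<open>The filter \<open>at_left T\<close> is proper, so nothing false can hold
        eventually.\<close>
      ultimately have "\<forall>\<^sub>F t in at_left T. False"
      proof eventually_elim
        case (elim t)
        have "K \<subseteq> flow_domain \<xi> t \<omega>"
        proof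
          fix x assume "x \<in> K"
          then have "ereal T \<le> \<xi> x \<omega>"
            unfolding T(1)[symmetric] explosion_time_on_def by (rule INF_lower)
          then show "x \<in> flow_domain \<xi> t \<omega>"
            using elim(2) less_le_trans[of "ereal t" "ereal T" "\<xi> x \<omega>"]
            by (simp add: flow_domain_def)
        qed
        then have "(\<lambda>x. F t x \<omega>) ` K \<subseteq> C"
          using C(2) elim(2) by simp
        then have "(SUP x\<in>K. ereal (d x0 (F t x \<omega>))) \<le> ereal R"
          using R by (intro SUP_least) auto
        then show ?case
          using elim(1) by simp
      qed
      then show False
        by simp
    qed
    then have "explosion_time_on \<xi> K \<omega> = \<infinity>"
      by simp
    then show ?case
      unfolding explosion_time_on_def by (metis INF_lower ereal_infty_less_eq(1))
  qed
qed

text \<open>One point of \<open>K\<close> is chosen from each basic open set that meets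
  \<open>K\<close>. A countable dense subset of the whole space would not do, since it may miss
  \<open>K\<close>.\<close>

lemma countable_dense_subset:
  fixes K :: "'a::second_countable_topology set"
  obtains Q where "countable Q" and "Q \<subseteq> K" and "K \<subseteq> closure Q"
proof -
  obtain B :: "'a set set" where B: "countable B" "topological_basis B"
    using ex_countable_basis by blast
  define pick where "pick b = (SOME x. x \<in> b \<inter> K)" for b
  define Q where "Q = pick ` {b \<in> B. b \<inter> K \<noteq> {}}"
  have pick: "pick b \<in> b \<inter> K" if "b \<inter> K \<noteq> {}" for b
    unfolding pick_def by (rule someI_ex) (use that in blast)
  show thesis
  proof
    show "countable Q"
      unfolding Q_def using B(1) by (intro countable_image) (auto intro: countable_subset)
    show "Q \<subseteq> K"
      using pick by (auto simp: Q_def)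
    show "K \<subseteq> closure Q"
    proof
      fix x assume x: "x \<in> K"
      show "x \<in> closure Q"
        unfolding closure_iff_nhds_not_empty
      proof (intro allI impI)
        fix A S assume "S \<subseteq> A" "open S" "x \<in> S"
        then obtain b where b: "b \<in> B" "x \<in> b" "b \<subseteq> S"
          using B(2) topological_basisE by metis
        then have "pick b \<in> Q" "pick b \<in> b"
          using x pick by (auto simp: Q_def)
        then show "Q \<inter> A \<noteq> {}"
          using b \<open>S \<subseteq> A\<close> by blast
      qed
    qed
  qed
qed

text \<open>The continuous version agrees with the flow simultaneously on a countable dense subset of
  \<open>K\<close>, which confines the images of \<open>K\<close>.\<close>

lemma strongly_complete_on_compact_no_explosion:
  fixes F :: "real \<Rightarrow> 'a::{t2_space, second_countable_topology} \<Rightarrow> 'w \<Rightarrow> 'a"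
  assumes flow: "partial_flow P \<A> d x0 F \<xi>" and d: "complete_metric_for_topology d" and K: "compact K"
    and compl: "strongly_complete_on P F \<xi> K"
  shows "AE \<omega> in P. \<forall>x\<in>K. \<xi> x \<omega> = \<infinity>"
\<comment> \<open>Each point of \<open>K\<close> has infinite lifetime off a null set of its own.
  Since \<open>K\<close> may be uncountable, a common null set is obtained through confinement
  instead.\<close>
proof (rule no_explosion_of_confined[OF flow d K])
  obtain G where G: "\<And>x. x \<in> K \<Longrightarrow> AE \<omega> in P. \<xi> x \<omega> = \<infinity> \<and> (\<forall>t\<ge>0. G t x \<omega> = F t x \<omega>)"
    "AE \<omega> in P. continuous_on ({0..} \<times> K) (\<lambda>(t, x). G t x \<omega>)"
    using compl unfolding strongly_complete_on_def by blast
  obtain Q where Q: "countable Q" "Q \<subseteq> K" "K \<subseteq> closure Q"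
    by (rule countable_dense_subset)
  have clQ: "closure Q = K"
    using Q closure_minimal compact_imp_closed[OF K] by blast
  have "AE \<omega> in P. \<forall>x\<in>Q. \<forall>t\<ge>0. G t x \<omega> = F t x \<omega>"
    using Q G(1) by (intro AE_ball_countable') (auto elim!: AE_mp)
  moreover have "AE \<omega> in P. \<forall>t\<ge>0. continuous_on (flow_domain \<xi> t \<omega>) (\<lambda>x. F t x \<omega>)"
    using flow unfolding partial_flow_def C1_diffeo_onto_open_def Ck_map_def by (auto elim!: AE_mp)
  ultimately show "AE \<omega> in P. \<forall>T\<ge>0. \<exists>C. compact C \<and>
      (\<forall>t. 0 \<le> t \<and> t \<le> T \<and> K \<subseteq> flow_domain \<xi> t \<omega> \<longrightarrow> (\<lambda>x. F t x \<omega>) ` K \<subseteq> C)"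
    using G(2)
  proof eventually_elim
    case (elim \<omega>)
    show ?case
    proof (intro allI impI)
      fix T :: real
      define C where "C = (\<lambda>(t, x). G t x \<omega>) ` ({0..T} \<times> K)"
      have "continuous_on ({0..T} \<times> K) (\<lambda>(t, x). G t x \<omega>)"
        using elim(3) by (rule continuous_on_subset) auto
      then have C: "compact C"
        unfolding C_def using K by (intro compact_continuous_image compact_Times) auto
      have "(\<lambda>x. F t x \<omega>) ` K \<subseteq> C" if t: "0 \<le> t" "t \<le> T" "K \<subseteq> flow_domain \<xi> t \<omega>" for t
      proof -
        \<comment> \<open>For this \<open>\<omega>\<close> the version \<open>G\<close> is known to
          agree with \<open>F\<close> only on \<open>Q\<close>; continuity of \<open>F\<close> at
          time \<open>t\<close> and closedness of \<open>C\<close> carry the inclusion over to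
          \<open>K\<close>.\<close>
        have "continuous_on (closure Q) (\<lambda>x. F t x \<omega>)"
          unfolding clQ using elim(2) t by (metis continuous_on_subset)
        moreover have "(\<lambda>x. F t x \<omega>) ` Q \<subseteq> C"
        proof
          fix y assume "y \<in> (\<lambda>x. F t x \<omega>) ` Q"
          then obtain x where "x \<in> Q" "y = G t x \<omega>"
            using elim(1) t(1) by auto
          then show "y \<in> C"
            unfolding C_def using t Q(2) by force
        qed
        ultimately show ?thesis
          using image_closure_subset compact_imp_closed[OF C] clQ by metis
      qed
      with C show "\<exists>C. compact C \<and>
          (\<forall>t. 0 \<le> t \<and> t \<le> T \<and> K \<subseteq> flow_domain \<xi> t \<omega> \<longrightarrow> (\<lambda>x. F t x \<omega>) ` K \<subseteq> C)"
        by blast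
    qed
  qed
qed

subsection \<open>Smooth simplices in charts\<close>

lemma subtopology_Euclidean_space:
  assumes "W \<subseteq> topspace (Euclidean_space N)"
  shows "subtopology (Euclidean_space N) W = top_of_set W"
  using assms
  by (simp add: Euclidean_space_def euclidean_product_topology subtopology_subtopology inf.absorb2)

lemma continuous_on_lincomb:
  fixes v :: "nat \<Rightarrow> 'b::real_normed_vector"
  shows "continuous_on S (\<lambda>x. \<Sum>i<N. x i *\<^sub>R v i)"
  by (intro continuous_intros continuous_on_subset[OF continuous_on_product_coordinates]) auto

text \<open>Changing one coordinate moves the combination along a line in direction
  \<open>v i\<close>, which turns partial derivatives into directional ones.\<close>

lemma lincomb_fun_upd:
  fixes v :: "nat \<Rightarrow> 'b::real_normed_vector"
  assumes "i < N"
  shows "(\<Sum>j<N. (x(i := t)) j *\<^sub>R v j) = (\<Sum>j<N. x j *\<^sub>R v j) + (t - x i) *\<^sub>R v i"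
proof -
  have "(\<Sum>j<N. (x(i := t)) j *\<^sub>R v j) = t *\<^sub>R v i + (\<Sum>j\<in>{..<N} - {i}. x j *\<^sub>R v j)"
    using assms by (subst sum.remove[of _ i]) auto
  also have "(\<Sum>j\<in>{..<N} - {i}. x j *\<^sub>R v j) = (\<Sum>j<N. x j *\<^sub>R v j) - x i *\<^sub>R v i"
    using assms by (subst (2) sum.remove[of _ i]) auto
  finally show ?thesis
    by (simp add: algebra_simps)
qed

text \<open>By the chain rule the \<open>i\<close>-th partial derivative is the derivative of
  \<open>h\<close> in direction \<open>v i\<close>, composed with \<open>L\<close>. It has the same
  shape as \<open>g\<close>, so induction on \<open>k\<close> applies with \<open>h\<close> and
  \<open>g\<close> arbitrary.\<close>

lemma Ck_on_imp_Ck_Euclidean: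
  fixes N :: nat and v :: "nat \<Rightarrow> 'b::real_normed_vector" and h :: "'b \<Rightarrow> 'c::real_normed_vector"
  defines "L \<equiv> \<lambda>x. \<Sum>i<N. x i *\<^sub>R v i"
  assumes "Ck_on k S h" and S: "open S" and W: "W = {x \<in> topspace (Euclidean_space N). L x \<in> S}"
    and "\<And>x. x \<in> W \<Longrightarrow> g x = h (L x)"
  shows "Ck_Euclidean N k W g"
proof -
  have cont: "continuous_map (subtopology (Euclidean_space N) W) euclidean g"
    if "continuous_on S h" and g: "\<And>x. x \<in> W \<Longrightarrow> g x = h (L x)"
    for h and g :: "(nat \<Rightarrow> real) \<Rightarrow> 'c"
  proof -
    have "continuous_on W L"
      unfolding L_def by (rule continuous_on_lincomb)
    then have "continuous_on W (\<lambda>x. h (L x))"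
      by (rule continuous_on_compose2[OF that(1)]) (use W in auto)
    then have "continuous_on W g"
      using g by (simp cong: continuous_on_cong)
    then show ?thesis
      using W by (auto simp: subtopology_Euclidean_space)
  qed
  show ?thesis
    using assms(2,5)
  proof (induction k arbitrary: h g)
    case (0 h g)
    then show ?case
      using cont by simp
  next
    case (Suc k h g)
    have diff: "h differentiable_on S"
      using Suc.prems by simp
    have der: "((\<lambda>t. g (x(i := t))) has_vector_derivative frechet_derivative h (at (L x)) (v i)) (at (x i))"
      if i: "i < N" and x: "x \<in> W" for i x
    proof -
      define l where "l t = L x + (t - x i) *\<^sub>R v i" for t
      have l: "L (x(i := t)) = l t" for t
        using lincomb_fun_upd[OF i] by (simp add: L_def l_def)
      have "L x \<in> S"
        using x W by blast
      then have "(h has_derivative frechet_derivative h (at (L x))) (at (l (x i)))"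
        using diff at_within_open[OF _ S]
        by (simp add: l_def differentiable_on_def frechet_derivative_works)
      moreover have "(l has_vector_derivative v i) (at (x i))"
        unfolding l_def by (auto intro!: derivative_eq_intros)
      ultimately have 1: "(h \<circ> l has_vector_derivative frechet_derivative h (at (L x)) (v i)) (at (x i))"
        using vector_derivative_diff_chain_within has_derivative_at_withinI by blast
      \<comment> \<open>The point \<open>x(i := t)\<close> is in \<open>W\<close> only while
        \<open>l t\<close> is in \<open>S\<close>, so \<open>g\<close> and
        \<open>h \<circ> l\<close> are compared on this neighbourhood of \<open>x i\<close>.\<close>
      have "open (l -` S)"
        using S by (intro open_vimage) (auto simp: l_def intro!: continuous_intros)
      then show ?thesis
      proof (rule has_vector_derivative_transform_within_open[OF 1])
        show "x i \<in> l -` S"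
          using \<open>L x \<in> S\<close> by (simp add: l_def)
        fix t assume "t \<in> l -` S"
        then have "x(i := t) \<in> W"
          using x i l W by (auto simp: topspace_Euclidean_space)
        then show "(h \<circ> l) t = g (x(i := t))"
          using Suc.prems(2) l by (metis comp_apply)
      qed
    qed
    have "Ck_Euclidean N k W (\<lambda>x. vector_derivative (\<lambda>t. g (x(i := t))) (at (x i)))" if "i < N" for i
    proof (rule Suc.IH)
      show "Ck_on k S (\<lambda>y. frechet_derivative h (at y) (v i))"
        using Suc.prems(1) by simp
    qed (rule vector_derivative_at[OF der[OF that]])
    then show ?case
      unfolding Ck_Euclidean.simps
      using cont[OF differentiable_imp_continuous_on[OF diff] Suc.prems(2)] der differentiableI_vector
      by blast
  qed
qed

text \<open>Points of the standard simplex serve as barycentric coordinates with respect to the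
  enumeration \<open>v\<close> of the vertices.\<close>

lemma lincomb_standard_simplex:
  fixes v :: "nat \<Rightarrow> 'b::real_normed_vector"
  assumes v: "bij_betw v {..<Suc p} S"
  shows "(\<lambda>x. \<Sum>i<Suc p. x i *\<^sub>R v i) ` standard_simplex p = convex hull S"
proof (intro equalityI subsetI)
  have fin: "finite S"
    using v bij_betw_finite by blast
  fix y
  {
    assume "y \<in> (\<lambda>x. \<Sum>i<Suc p. x i *\<^sub>R v i) ` standard_simplex p"
    then obtain x where x: "x \<in> standard_simplex p" "y = (\<Sum>i<Suc p. x i *\<^sub>R v i)"
      by blast
    show "y \<in> convex hull S"
      unfolding x(2)
    proof (rule convex_sum)
      show "sum x {..<Suc p} = 1"
        using x(1) by (simp add: standard_simplex_def lessThan_Suc_atMost)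
      show "v i \<in> convex hull S" if "i \<in> {..<Suc p}" for i
        using v that by (meson bij_betwE hull_inc)
    qed (use x in \<open>auto simp: standard_simplex_def\<close>)
  next
    assume "y \<in> convex hull S"
    then obtain u where u: "\<forall>x\<in>S. 0 \<le> u x" "sum u S = 1" "(\<Sum>x\<in>S. u x *\<^sub>R x) = y"
      using fin by (auto simp: convex_hull_finite)
    define x where "x i = (if i < Suc p then u (v i) else 0)" for i
    have vS: "v i \<in> S" if "i < Suc p" for i
      using v that by (meson bij_betwE lessThan_iff)
    have "u w \<le> 1" if "w \<in> S" for w
      using member_le_sum[of w S u] u fin that by auto
    then have "0 \<le> x i \<and> x i \<le> 1" for i
      using u(1) vS by (simp add: x_def)
    moreover have "(\<Sum>i\<le>p. x i) = 1"
      using sum.reindex_bij_betw[OF v, of u] u(2) by (simp add: x_def lessThan_Suc_atMost)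
    ultimately have "x \<in> standard_simplex p"
      by (auto simp: standard_simplex_def x_def)
    moreover have "y = (\<Sum>i<Suc p. x i *\<^sub>R v i)"
      using sum.reindex_bij_betw[OF v, of "\<lambda>w. u w *\<^sub>R w"] u(3) by (simp add: x_def)
    ultimately show "y \<in> (\<lambda>x. \<Sum>i<Suc p. x i *\<^sub>R v i) ` standard_simplex p"
      by blast
  }
qed

text \<open>The simplex is the affine parametrisation \<open>L\<close> followed by the inverse
  chart. Seen in another chart it is a transition map after \<open>L\<close>, hence smooth on the
  open set \<open>W\<close> where \<open>L\<close> takes values in the image of the chart.\<close>

lemma chart_simplex_in_smooth_simplex_images:
  fixes \<A> :: "('a::{t2_space, second_countable_topology}, 'n::finite) chart set"
  assumes mfd: "smooth_manifold \<A>" and c: "c \<in> \<A>" and S: "card S = Suc p"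
    and sub: "convex hull S \<subseteq> snd c ` fst c"
  shows "cinv c ` (convex hull S) \<in> smooth_simplex_images \<A> p"
proof -
  have ch: "is_chart c'" if "c' \<in> \<A>" for c'
    using mfd that by (simp add: smooth_manifold_def)
  note cD = chartD[OF ch[OF c]]
  have "finite S"
    using S card.infinite by fastforce
  then obtain v where v: "bij_betw v {..<Suc p} S"
    using ex_bij_betw_nat_finite S by (metis atLeast0LessThan)
  define L where "L x = (\<Sum>i<Suc p. x i *\<^sub>R v i)" for x
  have LK: "L ` standard_simplex p = convex hull S"
    using lincomb_standard_simplex[OF v] by (simp add: L_def)
  have L: "continuous_on T L" for T
    unfolding L_def by (rule continuous_on_lincomb)
  let ?E = "Euclidean_space (Suc p)"
  define W where "W = {x \<in> topspace ?E. L x \<in> snd c ` fst c}"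
  have stdE: "standard_simplex p \<subseteq> topspace ?E"
    by (auto simp: standard_simplex_def topspace_Euclidean_space)
  have stdW: "standard_simplex p \<subseteq> W"
    using stdE LK sub by (auto simp: W_def)
  have cg: "continuous_on W (cinv c \<circ> L)"
    using L by (intro continuous_on_compose continuous_on_subset[OF cD(4)]) (auto simp: W_def)
  have "openin ?E W"
  proof -
    have "open (L -` (snd c ` fst c))"
      using L cD(2) by (intro open_vimage)
    then have "openin (top_of_set (topspace ?E)) (topspace ?E \<inter> L -` (snd c ` fst c))"
      by blast
    moreover have "topspace ?E \<inter> L -` (snd c ` fst c) = W"
      by (auto simp: W_def)
    ultimately show ?thesis
      by (metis subtopology_Euclidean_space subtopology_topspace order_refl)
  qed
  moreover have "smooth_Euclidean_map \<A> (Suc p) W (cinv c \<circ> L)"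
    unfolding smooth_Euclidean_map_def
  proof (intro conjI ballI allI)
    show "continuous_map (subtopology ?E W) euclidean (cinv c \<circ> L)"
      using cg by (simp add: subtopology_Euclidean_space W_def)
    fix c' k assume c': "c' \<in> \<A>"
    let ?S = "snd c ` (fst c \<inter> fst c')"
    have "Ck_on k ?S (snd c' \<circ> cinv c)"
      using mfd c c' by (simp add: smooth_manifold_def smooth_on_def)
    moreover have "open ?S"
      using open_chart_image[OF ch[OF c]] cD(1) chartD(1)[OF ch[OF c']] by blast
    moreover have "W \<inter> (cinv c \<circ> L) -` fst c' = {x \<in> topspace ?E. L x \<in> ?S}"
      using cD(6) by (force simp: W_def)
    ultimately show "Ck_Euclidean (Suc p) k (W \<inter> (cinv c \<circ> L) -` fst c') (snd c' \<circ> (cinv c \<circ> L))"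
      unfolding L_def by (intro Ck_on_imp_Ck_Euclidean[where h = "snd c' \<circ> cinv c" and v = v]) auto
  qed
  \<comment> \<open>Singular simplices are extensional functions, hence the restriction;
    \<open>cinv c \<circ> L\<close> on \<open>W\<close> is its smooth extension.\<close>
  moreover have "singular_simplex p euclidean (restrict (cinv c \<circ> L) (standard_simplex p))"
  proof -
    have "continuous_on (standard_simplex p) (restrict (cinv c \<circ> L) (standard_simplex p))"
      using continuous_on_subset[OF cg stdW] by (simp cong: continuous_on_cong)
    then show ?thesis
      by (simp add: singular_simplex_def euclidean_product_topology)
  qed
  ultimately have "smooth_singular_simplex \<A> p (restrict (cinv c \<circ> L) (standard_simplex p))"
    unfolding smooth_singular_simplex_def using stdW by (intro conjI exI[of _ W] exI[of _ "cinv c \<circ> L"]) auto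
  moreover have "cinv c ` (convex hull S) = restrict (cinv c \<circ> L) (standard_simplex p) ` standard_simplex p"
    by (simp add: LK[symmetric] image_image)
  ultimately show ?thesis
    unfolding smooth_simplex_images_def by blast
qed

lemma compact_smooth_simplex_image:
  assumes "K \<in> smooth_simplex_images \<A> p"
  shows "compact K"
proof -
  have "compact (standard_simplex p)"
    using compactin_standard_simplex[of p] by (simp add: euclidean_product_topology)
  then show ?thesis
    using assms compact_continuous_image
    unfolding smooth_simplex_images_def smooth_singular_simplex_def singular_simplex_def
    by (auto simp: euclidean_product_topology)
qed

text \<open>A small copy of the standard simplex, moved so that an interior point \<open>a\<close>
  lands on \<open>x\<close>. Affine independence and the number of vertices are recorded for the
  description of its frontier by facets.\<close>

lemma simplex_neighbourhood:
  fixes x :: "'b::euclidean_space"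
  assumes "open U" and "x \<in> U"
  obtains S where "\<not> affine_dependent S" and "card S = Suc DIM('b)"
    and "x \<in> interior (convex hull S)" and "convex hull S \<subseteq> U"
proof -
  let ?B = "insert 0 Basis :: 'b set"
  obtain e where e: "e > 0" "cball x e \<subseteq> U"
    using assms open_contains_cball by blast
  obtain a :: 'b where a: "a \<in> interior (convex hull ?B)"
    using interior_std_simplex_nonempty by blast
  have "bounded ((\<lambda>y. y - a) ` (convex hull ?B))"
    by (intro bounded_translation_minus compact_imp_bounded compact_convex_hull) (simp add: finite_imp_compact)
  then obtain R where R: "R > 0" "\<And>y. y \<in> convex hull ?B \<Longrightarrow> norm (y - a) \<le> R"
    unfolding bounded_pos by auto
  \<comment> \<open>This factor shrinks the simplex from radius \<open>R\<close> about
    \<open>a\<close> to radius \<open>e\<close> about \<open>x\<close>.\<close>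
  define r where "r = e / R"
  have r: "r > 0"
    using e R by (simp add: r_def)
  define f where "f = (+) (x - r *\<^sub>R a) \<circ> (*\<^sub>R) r"
  have f: "f y = x + r *\<^sub>R (y - a)" for y
    by (simp add: f_def algebra_simps)
  have hull: "convex hull (f ` ?B) = f ` (convex hull ?B)"
    unfolding f_def image_comp[symmetric] by (simp only: convex_hull_translation convex_hull_scaling)
  have inj: "inj ((*\<^sub>R) r :: 'b \<Rightarrow> 'b)"
    using r by (simp add: inj_on_def)
  have lin: "linear ((*\<^sub>R) r :: 'b \<Rightarrow> 'b)"
    by (simp add: linear_scale_self)
  have "independent ((*\<^sub>R) r ` (Basis :: 'b set))"
    using linear_independent_injective_image[OF lin] independent_Basis inj by (metis inj_on_subset subset_UNIV)
  then have "\<not> affine_dependent (insert 0 ((*\<^sub>R) r ` (Basis :: 'b set)))"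
    using r by (subst affine_dependent_iff_dependent) auto
  then have "\<not> affine_dependent (f ` ?B)"
    unfolding f_def image_comp[symmetric] affine_dependent_translation_eq[symmetric] by simp
  moreover have "card (f ` ?B) = Suc DIM('b)"
    using r by (subst card_image) (auto simp: inj_on_def f)
  moreover have "x \<in> interior (convex hull (f ` ?B))"
  proof -
    have "interior (f ` (convex hull ?B)) = f ` interior (convex hull ?B)"
      unfolding f_def image_comp[symmetric]
      using interior_translation interior_injective_linear_image[OF lin inj] by metis
    moreover have "x = f a"
      by (simp add: f)
    ultimately show ?thesis
      using a hull by auto
  qed
  moreover have "convex hull (f ` ?B) \<subseteq> U"
  proof -
    have "f y \<in> cball x e" if "y \<in> convex hull ?B" for y
    proof -
      have "dist x (f y) = r * norm (y - a)"
        using r by (simp add: f dist_norm del: scaleR_right_diff_distrib)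
      also have "\<dots> \<le> r * R"
        using R(2)[OF that] r by simp
      also have "\<dots> = e"
        using R(1) by (simp add: r_def)
      finally show ?thesis
        by simp
    qed
    then show ?thesis
      unfolding hull by (rule order_trans[OF image_subsetI e(2)])
  qed
  ultimately show thesis
    by (rule that)
qed

text \<open>The image under the inverse chart of a full-dimensional simplex, with \<open>U\<close>
  the image of its interior. Its boundary consists of the facets, each spanned by all vertices but
  one.\<close>

lemma manifold_simplex_neighbourhood:
  fixes \<A> :: "('a::{t2_space, second_countable_topology}, 'n::finite) chart set" and x :: 'a
  assumes mfd: "smooth_manifold \<A>"
  obtains K U \<K> where "compact K" and "open U" and "x \<in> U" and "U \<subseteq> K"
    and "finite \<K>" and "\<K> \<subseteq> smooth_simplex_images \<A> (CARD('n) - 1)" and "K - U \<subseteq> \<Union>\<K>"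
proof -
  obtain c where c: "c \<in> \<A>" "is_chart c" "x \<in> fst c"
    using manifold_chart_at[OF mfd] by metis
  note cD = chartD[OF c(2)]
  obtain S where S: "\<not> affine_dependent S" "card S = Suc DIM(real ^ 'n)"
    "snd c x \<in> interior (convex hull S)" "convex hull S \<subseteq> snd c ` fst c"
    using simplex_neighbourhood[OF cD(2)] c(3) by (metis imageI)
  have fin: "finite S"
    using S(1) aff_independent_finite by blast
  have comp: "compact (convex hull S)"
    using fin by (simp add: compact_convex_hull finite_imp_compact)
  have "frontier (convex hull S) = \<Union>{convex hull (S - {a}) |a. a \<in> S}"
    using frontier_convex_hull_cases[OF S(1)] S(2) by simp
  then have fr: "convex hull S - interior (convex hull S) \<subseteq> (\<Union>a\<in>S. convex hull (S - {a}))"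
    using compact_imp_closed[OF comp] by (auto simp: frontier_def)
  let ?\<K> = "(\<lambda>a. cinv c ` (convex hull (S - {a}))) ` S"
  show thesis
  proof
    show "compact (cinv c ` (convex hull S))"
      by (rule compact_continuous_image[OF continuous_on_subset[OF cD(4) S(4)] comp])
    show "open (cinv c ` interior (convex hull S))"
      using open_chart_preimage[OF c(2)] S(4) interior_subset by blast
    show "x \<in> cinv c ` interior (convex hull S)"
      using S(3) cD(6)[OF c(3)] by (metis imageI)
    show "cinv c ` interior (convex hull S) \<subseteq> cinv c ` (convex hull S)"
      by (simp add: image_mono interior_subset)
    show "finite ?\<K>"
      using fin by simp
    show "?\<K> \<subseteq> smooth_simplex_images \<A> (CARD('n) - 1)"
    proof
      fix Q assume "Q \<in> ?\<K>"
      then obtain a where a: "Q = cinv c ` (convex hull (S - {a}))" "a \<in> S"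
        by (rule imageE)
      \<comment> \<open>The subtraction does not truncate, because an index type has at least one
        element.\<close>
      have "card (S - {a}) = Suc (CARD('n) - 1)"
        using a(2) S(2) fin by simp
      moreover have "convex hull (S - {a}) \<subseteq> snd c ` fst c"
        using S(4) hull_mono[of "S - {a}" S] by blast
      ultimately show "Q \<in> smooth_simplex_images \<A> (CARD('n) - 1)"
        unfolding a(1) by (rule chart_simplex_in_smooth_simplex_images[OF mfd c(1)])
    qed
    show "cinv c ` (convex hull S) - cinv c ` interior (convex hull S) \<subseteq> \<Union>?\<K>"
      using fr by blast
  qed
qed

subsection \<open>Strong completeness\<close>

text \<open>Confinement is used twice: on each facet it comes from the continuous version of the
  flow, and on the solid simplex from the facets acting as a barrier.\<close>

lemma strongly_p_complete_imp_no_explosion_locally: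
  fixes \<A> :: "('a::{t2_space, second_countable_topology}, 'n::finite) chart set"
  assumes mfd: "smooth_manifold \<A>" and conn: "connected (UNIV :: 'a set)"
    and d: "complete_metric_for_topology d" and flow: "partial_flow P \<A> d x0 F \<xi>"
    and compl: "strongly_p_complete P \<A> F \<xi> (CARD('n) - 1)"
  obtains U where "open U" and "x \<in> U" and "AE \<omega> in P. \<forall>y\<in>U. \<xi> y \<omega> = \<infinity>"
proof -
  obtain K U \<K> where K: "compact K" and U: "open U" "x \<in> U" "U \<subseteq> K"
    and \<K>: "finite \<K>" "\<K> \<subseteq> smooth_simplex_images \<A> (CARD('n) - 1)" "K - U \<subseteq> \<Union>\<K>"
    using manifold_simplex_neighbourhood[OF mfd] .
  have "AE \<omega> in P. \<forall>y\<in>Q. \<xi> y \<omega> = \<infinity>" if "Q \<in> \<K>" for Q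
    using strongly_complete_on_compact_no_explosion[OF flow d compact_smooth_simplex_image] that \<K>(2) compl
    unfolding strongly_p_complete_def by blast
  then have "AE \<omega> in P. \<forall>Q\<in>\<K>. \<forall>y\<in>Q. \<xi> y \<omega> = \<infinity>"
    by (rule AE_finite_allI[OF \<K>(1)])
  moreover have "AE \<omega> in P. C1_continuous_in_time \<A> (\<lambda>t. flow_domain \<xi> t \<omega>) (\<lambda>t x. F t x \<omega>) \<and>
      (\<forall>t\<ge>0. open (flow_domain \<xi> t \<omega>) \<and> C1_diffeo_onto_open \<A> (flow_domain \<xi> t \<omega>) (\<lambda>x. F t x \<omega>))"
    using flow unfolding partial_flow_def by (auto elim!: AE_mp)
  ultimately have "AE \<omega> in P. \<forall>T\<ge>0. \<exists>C. compact C \<and>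
      (\<forall>t. 0 \<le> t \<and> t \<le> T \<and> K \<subseteq> flow_domain \<xi> t \<omega> \<longrightarrow> (\<lambda>x. F t x \<omega>) ` K \<subseteq> C)"
  proof eventually_elim
    case (elim \<omega>)
    have bd: "K - U \<subseteq> flow_domain \<xi> t \<omega>" for t
      using elim(1) \<K>(3) by (force simp: flow_domain_def)
    show ?case
    proof (intro allI impI)
      fix T :: real
      obtain C where "compact C"
        "\<And>t. 0 \<le> t \<Longrightarrow> t \<le> T \<Longrightarrow> K \<subseteq> flow_domain \<xi> t \<omega> \<Longrightarrow> (\<lambda>x. F t x \<omega>) ` K \<subseteq> C"
        using flow_images_confined[OF mfd conn, of "\<lambda>t. flow_domain \<xi> t \<omega>" "\<lambda>t x. F t x \<omega>" K U T]
          elim(2) K U bd by metis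
      then show "\<exists>C. compact C \<and>
          (\<forall>t. 0 \<le> t \<and> t \<le> T \<and> K \<subseteq> flow_domain \<xi> t \<omega> \<longrightarrow> (\<lambda>x. F t x \<omega>) ` K \<subseteq> C)"
        by blast
    qed
  qed
  then have "AE \<omega> in P. \<forall>y\<in>K. \<xi> y \<omega> = \<infinity>"
    by (rule no_explosion_of_confined[OF flow d K])
  then have "AE \<omega> in P. \<forall>y\<in>U. \<xi> y \<omega> = \<infinity>"
    using U(3) by (auto elim!: AE_mp)
  then show thesis
    using that U by blast
qed

theorem theorem2p3:
  fixes \<A> :: "('a::{t2_space, second_countable_topology}, 'n::finite) chart set"
    and P :: "'w measure" and \<F> :: "real \<Rightarrow> 'w measure"
    and B :: "real \<Rightarrow> 'w \<Rightarrow> real ^ 'm::finite"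
    and X :: "real ^ 'm \<Rightarrow> 'a \<Rightarrow> ('a, 'n) tangent"
    and A :: "'a \<Rightarrow> ('a, 'n) tangent"
    and F :: "real \<Rightarrow> 'a \<Rightarrow> 'w \<Rightarrow> 'a" and \<xi> :: "'a \<Rightarrow> 'w \<Rightarrow> ereal"
    and d :: "'a \<Rightarrow> 'a \<Rightarrow> real" and x0 :: 'a
  assumes "smooth_manifold \<A>" and "connected (UNIV :: 'a set)"
    and "complete_metric_for_topology d"
    and "filtered_prob_space P \<F>" and "brownian_motion P \<F> B"
    and "C2_diffusion_coefficient \<A> X" and "C2_vector_field \<A> A"
    and "\<And>x. sde_solution_from P \<F> B \<A> X A F \<xi> x"
    and "partial_flow P \<A> d x0 F \<xi>"
    and "strongly_p_complete P \<A> F \<xi> (CARD('n) - 1)"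
  shows "strongly_complete P F \<xi>"
proof -
  let ?safe = "\<lambda>U. AE \<omega> in P. \<forall>y\<in>U. \<xi> y \<omega> = \<infinity>"
  \<comment> \<open>The null set depends on the neighbourhood \<open>U\<close>; the Lindelof
    property leaves countably many of them to unite.\<close>
  obtain \<U> where \<U>: "\<U> \<subseteq> {U. open U \<and> ?safe U}" "countable \<U>" "\<Union>\<U> = \<Union>{U. open U \<and> ?safe U}"
    using Lindelof[of "{U. open U \<and> ?safe U}"] by blast
  have cover: "x \<in> \<Union>\<U>" for x
    using strongly_p_complete_imp_no_explosion_locally[OF assms(1-3,9,10), of x] \<U>(3) by blast
  have "AE \<omega> in P. \<forall>U\<in>\<U>. \<forall>y\<in>U. \<xi> y \<omega> = \<infinity>"
    using \<U>(1) by (subst AE_ball_countable[OF \<U>(2)]) blast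
  then have inf: "AE \<omega> in P. \<forall>x. \<xi> x \<omega> = \<infinity>"
    by (rule eventually_mono) (use cover in blast)
  have "AE \<omega> in P. C1_continuous_in_time \<A> (\<lambda>t. flow_domain \<xi> t \<omega>) (\<lambda>t x. F t x \<omega>) \<and>
      (\<forall>t\<ge>0. open (flow_domain \<xi> t \<omega>) \<and> continuous_on (flow_domain \<xi> t \<omega>) (\<lambda>x. F t x \<omega>))"
    using assms(9) unfolding partial_flow_def C1_diffeo_onto_open_def Ck_map_def by (auto elim!: AE_mp)
  with inf have "AE \<omega> in P. continuous_on ({0..} \<times> UNIV) (\<lambda>(t, x). F t x \<omega>)"
  proof eventually_elim
    case (elim \<omega>)
    have "flow_domain \<xi> t \<omega> = UNIV" for t
      using elim(1) by (simp add: flow_domain_def)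
    then show ?case
      using C1_continuous_in_time_imp_continuous_on[OF assms(1), of "\<lambda>t. flow_domain \<xi> t \<omega>" "\<lambda>t x. F t x \<omega>"]
        elim(2) by simp
  qed
  \<comment> \<open>The flow is itself the jointly continuous version, so \<open>G\<close> is taken
    to be \<open>F\<close>.\<close>
  moreover have "AE \<omega> in P. \<xi> x \<omega> = \<infinity> \<and> (\<forall>t\<ge>0. F t x \<omega> = F t x \<omega>)" for x
    using inf by (auto elim!: AE_mp)
  ultimately show ?thesis
    unfolding strongly_complete_def strongly_complete_on_def by blast
qed

end
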